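(* Let $m,n$ be positive integers and $a,b$ non-negative integers with $a+b=n$ and $a$ even. Let $x_1,\ldots,x_a,y_1,\ldots,y_b$ be complex numbers with $x_1+\cdots+x_a+y_1+\cdots+y_b=0$. Define \[ R_{2,3}(m,n;\tau)= mn\, q^{\frac{a}{4}}\sum_{\substack{r_1,\ldots,r_a,s_1,\ldots,s_b\in\mathbb{Z}\\ 2(r_1+\cdots+r_a+s_1+\cdots+s_b)+a=0}}q^{r_1^2+\cdots+r_a^2+s_1^2+\cdots+s_b^2+r_1+\cdots+r_a}e^{i(2r_1x_1+\cdots+2r_ax_a+2s_1y_1+\cdots+2s_by_b+x_1+\cdots+x_a)}. \] Then for all $z\in\mathbb{C}$, \[ \sum_{k=0}^{mn-1}\prod_{j=1}^{a}\vartheta_2\!\left(z+x_j+\tfrac{k\pi}{mn}\Big|\tau\right)\prod_{i=1}^{b}\vartheta_3\!\left(z+y_i+\tfrac{k\pi}{mn}\Big|\tau\right)=R_{2,3}(m,n;\tau)\,\vartheta_3(mnz\,|\,m^2n\tau). \]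
   Context: Throughout, $\tau\in\mathbb{C}$ with $\Im(\tau)>0$, $q=e^{\pi i\tau}$, and $q^{\alpha}$ means $e^{\pi i\alpha\tau}$ for real $\alpha$. The Jacobi theta functions are $\vartheta_1(z|\tau)=-iq^{1/4}\sum_{n\in\mathbb{Z}}(-1)^nq^{n(n+1)}e^{(2n+1)iz}$, $\vartheta_2(z|\tau)=q^{1/4}\sum_{n\in\mathbb{Z}}q^{n(n+1)}e^{(2n+1)iz}$, $\vartheta_3(z|\tau)=\sum_{n\in\mathbb{Z}}q^{n^2}e^{2niz}$, $\vartheta_4(z|\tau)=\sum_{n\in\mathbb{Z}}(-1)^nq^{n^2}e^{2niz}$; and $\vartheta_j(z|m^2n\tau)$ denotes the same function with $\tau$ replaced by $m^2n\tau$. An empty product equals $1$. *)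

theory Defs
  imports "HOL-Analysis.Analysis"
begin

text \<open>
  \<open>qpow \<tau> \<alpha>\<close> is $q^\alpha = e^{\pi i \alpha \tau}$, where $q = e^{\pi i \tau}$; it is not the
  principal-branch power of the complex number $q$.
\<close>
definition qpow :: "complex \<Rightarrow> real \<Rightarrow> complex" where
  "qpow \<tau> \<alpha> = exp (complex_of_real pi * \<i> * complex_of_real \<alpha> * \<tau>)"

definition jacobi_theta2 :: "complex \<Rightarrow> complex \<Rightarrow> complex" where
  "jacobi_theta2 z \<tau> =
     qpow \<tau> (1/4) *
     (\<Sum>\<^sub>\<infinity>n\<in>(UNIV :: int set). qpow \<tau> (of_int (n * (n + 1))) * exp (of_int (2 * n + 1) * \<i> * z))"

definition jacobi_theta3 :: "complex \<Rightarrow> complex \<Rightarrow> complex" where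
  "jacobi_theta3 z \<tau> =
     (\<Sum>\<^sub>\<infinity>n\<in>(UNIV :: int set). qpow \<tau> (of_int (n ^ 2)) * exp (of_int (2 * n) * \<i> * z))"

text \<open>
  Integer tuples $(r_1,\dots,r_a)$ and $(s_1,\dots,s_b)$ are extensional functions on
  \<open>{1..a}\<close> and \<open>{1..b}\<close>, so that each tuple is counted exactly once in a sum.
\<close>
definition R23_indices :: "nat \<Rightarrow> nat \<Rightarrow> ((nat \<Rightarrow> int) \<times> (nat \<Rightarrow> int)) set" where
  "R23_indices a b =
     {(r, s). r \<in> {1..a} \<rightarrow>\<^sub>E UNIV \<and> s \<in> {1..b} \<rightarrow>\<^sub>E UNIV \<and>
        2 * ((\<Sum>j=1..a. r j) + (\<Sum>i=1..b. s i)) + int a = 0}"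

definition R23 ::
  "nat \<Rightarrow> nat \<Rightarrow> nat \<Rightarrow> nat \<Rightarrow> (nat \<Rightarrow> complex) \<Rightarrow> (nat \<Rightarrow> complex) \<Rightarrow> complex \<Rightarrow> complex" where
  "R23 m n a b x y \<tau> =
     of_nat (m * n) * qpow \<tau> (real a / 4) *
     (\<Sum>\<^sub>\<infinity>(r, s)\<in>R23_indices a b.
        qpow \<tau> (of_int ((\<Sum>j=1..a. (r j)\<^sup>2) + (\<Sum>i=1..b. (s i)\<^sup>2) + (\<Sum>j=1..a. r j))) *
        exp (\<i> * ((\<Sum>j=1..a. 2 * of_int (r j) * x j) + (\<Sum>i=1..b. 2 * of_int (s i) * y i)
                  + (\<Sum>j=1..a. x j))))"

end

theory Submission
  imports Defs
begin

text \<open>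
  Expanding the theta products into one absolutely convergent series over integer tuples, the term
  of $(r, s)$ carries the factor $e^{2iM(z + k\pi/(mn))}$ with $M = \sum r_j + \sum s_i + a/2$.
  Summing over $k$ kills every term with $mn \nmid M$. If $M = mnp$, subtracting $mp$ from each of
  the $n$ entries gives a tuple with $M = 0$; as the $x_j$ and $y_i$ add up to zero, the term
  changes only by $q^{m^2np^2} e^{2imnpz}$, and the sum over $p$ is the theta function on the right.
\<close>

no_notation Infinite_Set_Sum.abs_summable_on (infix \<open>abs'_summable'_on\<close> 50)

section \<open>Absolutely convergent series and sums over roots of unity\<close>

lemma summable_on_exp_neg_abs_int:
  "(\<lambda>n::int. exp (- real_of_int \<bar>n\<bar>)) summable_on UNIV"
proof -
  have "summable (\<lambda>n. norm (exp (-1::real) ^ n))"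
    by (simp add: summable_geometric)
  then have "(\<lambda>n::nat. exp (-1::real) ^ n) summable_on UNIV"
    by (rule norm_summable_imp_summable_on)
  then have nat: "(\<lambda>n::nat. exp (- real n)) summable_on UNIV"
    by (simp add: exp_of_nat_mult [symmetric])
  \<comment> \<open>The geometric series with ratio 1/e is moved to the non-negative and to the
    non-positive integers; the overlap at 0 is harmless for summability.\<close>
  have "(\<lambda>n::int. exp (- real_of_int \<bar>n\<bar>)) summable_on range int"
    by (subst summable_on_reindex) (use nat in \<open>auto simp: o_def\<close>)
  moreover have "(\<lambda>n::int. exp (- real_of_int \<bar>n\<bar>)) summable_on range (\<lambda>n. - int n)"
    by (subst summable_on_reindex) (use nat in \<open>auto simp: o_def inj_on_def\<close>)
  ultimately have "(\<lambda>n::int. exp (- real_of_int \<bar>n\<bar>)) summable_on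
      (range int \<union> range (\<lambda>n. - int n))"
    by (rule summable_on_union)
  moreover have "n \<in> range int \<union> range (\<lambda>n. - int n)" for n
    by (cases n rule: int_cases2) auto
  ultimately show ?thesis
    by (metis UNIV_eq_I)
qed

text \<open>Quadratic decay beats any linear growth: completing the square bounds the norm of the
  term by a constant times \<open>exp (- \<bar>n\<bar>)\<close>.\<close>

lemma abs_summable_exp_quadratic:
  fixes u v :: complex
  assumes "Re u < 0"
  shows "(\<lambda>n::int. exp (u * of_int (n\<^sup>2) + v * of_int n)) abs_summable_on UNIV"
proof (rule Infinite_Sum.abs_summable_on_comparison_test')
  define c where "c = - Re u"
  \<comment> \<open>The extra 1 leaves the decay \<open>- \<bar>n\<bar>\<close> once the linear term
    is absorbed. The constant \<open>d\<^sup>2 / (4 * c)\<close> is the maximum of d t - c t^2 over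
    real t.\<close>
  define d where "d = \<bar>Re v\<bar> + 1"
  have "c > 0"
    using assms by (simp add: c_def)
  show "(\<lambda>n::int. exp (d\<^sup>2 / (4 * c)) * exp (- real_of_int \<bar>n\<bar>)) summable_on UNIV"
    by (intro summable_on_cmult_right summable_on_exp_neg_abs_int)
  fix n :: int
  have "Re v * n \<le> \<bar>Re v\<bar> * \<bar>n\<bar>"
    by (metis abs_ge_self abs_mult of_int_abs)
  moreover have "d * \<bar>n\<bar> \<le> c * n\<^sup>2 + d\<^sup>2 / (4 * c)"
  proof -
    have "0 \<le> (2 * c * \<bar>n\<bar> - d)\<^sup>2 / (4 * c)"
      using \<open>c > 0\<close> by simp
    also have "\<dots> = c * n\<^sup>2 + d\<^sup>2 / (4 * c) - d * \<bar>n\<bar>"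
      using \<open>c > 0\<close> by (simp add: field_simps power2_eq_square)
    finally show ?thesis by simp
  qed
  ultimately have "Re u * n\<^sup>2 + Re v * n \<le> d\<^sup>2 / (4 * c) + - real_of_int \<bar>n\<bar>"
    by (simp add: c_def d_def algebra_simps)
  then show "norm (exp (u * of_int (n\<^sup>2) + v * of_int n))
      \<le> exp (d\<^sup>2 / (4 * c)) * exp (- real_of_int \<bar>n\<bar>)"
    by (simp flip: exp_add of_int_power)
qed

text \<open>Serves twice: to separate r from s when expanding the theta products, and to split off
  the theta function in p at the end.\<close>

lemma
  fixes f :: "'a \<Rightarrow> 'c :: {real_normed_field, banach}" and g :: "'b \<Rightarrow> 'c"
  assumes f: "f abs_summable_on A" and g: "g abs_summable_on B"
  shows abs_summable_on_times: "(\<lambda>(x, y). f x * g y) abs_summable_on (A \<times> B)"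
    and infsum_times: "(\<Sum>\<^sub>\<infinity>(x, y)\<in>A \<times> B. f x * g y) = infsum f A * infsum g B"
proof -
  show *: "(\<lambda>(x, y). f x * g y) abs_summable_on (A \<times> B)"
    unfolding Infinite_Sum.abs_summable_on_Sigma_iff
    using f g by (auto simp: norm_mult infsum_cmult_right' abs_mult
        intro!: summable_on_cmult_right summable_on_cmult_left)
  show "(\<Sum>\<^sub>\<infinity>(x, y)\<in>A \<times> B. f x * g y) = infsum f A * infsum g B"
    using infsum_Sigma'_banach [OF abs_summable_summable [OF *]]
    by (simp add: infsum_cmult_right' infsum_cmult_left')
qed

lemma has_sum_finite_sum:
  fixes f :: "'i \<Rightarrow> 'a \<Rightarrow> 'b :: topological_comm_monoid_add"
  assumes "\<And>k. k \<in> K \<Longrightarrow> (f k has_sum S k) A"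
  shows "((\<lambda>x. \<Sum>k\<in>K. f k x) has_sum (\<Sum>k\<in>K. S k)) A"
  \<comment> \<open>For infinite \<open>K\<close> both sums over \<open>K\<close> have the default
    value 0.\<close>
  using assms by (induction K rule: infinite_finite_induct) (auto intro: has_sum_add)

text \<open>A geometric sum in the N-th root of unity w = exp(2 pi i M / N). If w differs from 1, it
  equals (w^N - 1) / (w - 1) = 0; and w = 1 exactly when N divides M.\<close>

lemma sum_exp_roots_of_unity:
  fixes M :: int
  assumes "N > 0"
  shows "(\<Sum>k<N. exp (2 * \<i> * of_int M * (of_nat k * of_real pi / of_nat N)))
         = (if int N dvd M then of_nat N else (0 :: complex))"
proof -
  define w where "w = exp (2 * \<i> * of_int M * of_real pi / of_nat N)"
  have w_pow: "exp (2 * \<i> * of_int M * (of_nat k * of_real pi / of_nat N)) = w ^ k" for k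
    by (simp add: w_def exp_of_nat_mult [symmetric] algebra_simps)
  have "w ^ N = exp (2 * of_int M * of_real pi * \<i>)"
    using assms by (simp add: w_def exp_of_nat_mult [symmetric] algebra_simps)
  also have "\<dots> = 1"
    using exp_integer_2pi [of "of_int M"] by simp
  finally have w_N: "w ^ N = 1" .
  have "w = 1 \<longleftrightarrow> (\<exists>l::int. real_of_int M = real_of_int (int N * l))"
    using assms by (auto simp: w_def exp_eq_1 field_simps)
  also have "\<dots> \<longleftrightarrow> int N dvd M"
    by (simp only: of_int_eq_iff dvd_def)
  finally have "w = 1 \<longleftrightarrow> int N dvd M" .
  then show ?thesis
    unfolding w_pow using w_N by (auto simp: geometric_sum)
qed

section \<open>Terms of the theta series and of their products\<close>

definition theta2_term :: "complex \<Rightarrow> complex \<Rightarrow> int \<Rightarrow> complex" where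
  "theta2_term \<tau> z n =
     qpow \<tau> (1/4) * (qpow \<tau> (of_int (n * (n + 1))) * exp (of_int (2 * n + 1) * \<i> * z))"

definition theta3_term :: "complex \<Rightarrow> complex \<Rightarrow> int \<Rightarrow> complex" where
  "theta3_term \<tau> z n = qpow \<tau> (of_int (n ^ 2)) * exp (of_int (2 * n) * \<i> * z)"

lemma jacobi_theta2_infsum: "jacobi_theta2 z \<tau> = infsum (theta2_term \<tau> z) UNIV"
  unfolding jacobi_theta2_def theta2_term_def [abs_def] by (rule infsum_cmult_right' [symmetric])

lemma jacobi_theta3_infsum: "jacobi_theta3 z \<tau> = infsum (theta3_term \<tau> z) UNIV"
  unfolding jacobi_theta3_def theta3_term_def [abs_def] ..

lemma abs_summable_theta3_term:
  assumes "Im \<tau> > 0"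
  shows "theta3_term \<tau> z abs_summable_on UNIV"
proof -
  have "theta3_term \<tau> z = (\<lambda>n. exp ((of_real pi * \<i> * \<tau>) * of_int (n\<^sup>2) + (2 * \<i> * z) * of_int n))"
    by (simp add: theta3_term_def qpow_def fun_eq_iff algebra_simps flip: exp_add)
  then show ?thesis
    using abs_summable_exp_quadratic [of "of_real pi * \<i> * \<tau>" "2 * \<i> * z"] assms by simp
qed

lemma abs_summable_theta2_term:
  assumes "Im \<tau> > 0"
  shows "theta2_term \<tau> z abs_summable_on UNIV"
proof -
  have "theta2_term \<tau> z = (\<lambda>n. (qpow \<tau> (1/4) * exp (\<i> * z)) *
      exp ((of_real pi * \<i> * \<tau>) * of_int (n\<^sup>2) + (of_real pi * \<i> * \<tau> + 2 * \<i> * z) * of_int n))"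
    by (simp add: theta2_term_def qpow_def fun_eq_iff algebra_simps power2_eq_square flip: exp_add)
  then show ?thesis
    using abs_summable_exp_quadratic [of "of_real pi * \<i> * \<tau>" "of_real pi * \<i> * \<tau> + 2 * \<i> * z"] assms
    by (simp add: norm_mult summable_on_cmult_right)
qed

definition R23_term ::
  "nat \<Rightarrow> nat \<Rightarrow> (nat \<Rightarrow> complex) \<Rightarrow> (nat \<Rightarrow> complex) \<Rightarrow> complex \<Rightarrow>
   (nat \<Rightarrow> int) \<times> (nat \<Rightarrow> int) \<Rightarrow> complex" where
  "R23_term a b x y \<tau> = (\<lambda>(r, s).
     qpow \<tau> (of_int ((\<Sum>j=1..a. (r j)\<^sup>2) + (\<Sum>i=1..b. (s i)\<^sup>2) + (\<Sum>j=1..a. r j))) *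
     exp (\<i> * ((\<Sum>j=1..a. 2 * of_int (r j) * x j) + (\<Sum>i=1..b. 2 * of_int (s i) * y i)
               + (\<Sum>j=1..a. x j))))"

text \<open>The coefficient of i z in the exponent is the sum of all 2 r_j + 1 and 2 s_i; as
  \<open>a = 2 * c\<close>, it is twice an integer. The prefactors \<open>qpow \<tau> (1/4)\<close>
  contained in the \<open>theta2_term\<close> factors combine to
  \<open>qpow \<tau> (real a / 4)\<close>.\<close>

lemma prod_theta_terms:
  assumes a: "a = 2 * c"
  shows "(\<Prod>j=1..a. theta2_term \<tau> (z + x j) (r j)) * (\<Prod>i=1..b. theta3_term \<tau> (z + y i) (s i))
    = qpow \<tau> (real a / 4) * R23_term a b x y \<tau> (r, s) *
      exp (2 * \<i> * of_int ((\<Sum>j=1..a. r j) + (\<Sum>i=1..b. s i) + int c) * z)"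
proof -
  have "(\<Prod>j=1..a. theta2_term \<tau> (z + x j) (r j)) =
      exp (\<Sum>j=1..a. of_real pi * \<i> * \<tau> * (1/4 + (of_int (r j))\<^sup>2 + of_int (r j))
        + (2 * of_int (r j) + 1) * \<i> * (z + x j))"
    unfolding exp_sum [OF finite_atLeastAtMost]
    by (rule prod.cong)
       (simp_all add: theta2_term_def qpow_def algebra_simps power2_eq_square flip: exp_add)
  moreover have "(\<Prod>i=1..b. theta3_term \<tau> (z + y i) (s i)) =
      exp (\<Sum>i=1..b. of_real pi * \<i> * \<tau> * (of_int (s i))\<^sup>2 + 2 * of_int (s i) * \<i> * (z + y i))"
    unfolding exp_sum [OF finite_atLeastAtMost]
    by (rule prod.cong) (simp_all add: theta3_term_def qpow_def algebra_simps flip: exp_add)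
  ultimately show ?thesis
    by (simp add: R23_term_def qpow_def a algebra_simps sum.distrib sum_distrib_left
        flip: exp_add)
qed

text \<open>The exponent of q grows by (a + b) t^2 + 2 t (sum r + sum s + c), where the c comes from
  the linear part sum r'; the bracket vanishes by \<open>rs\<close>. The other exponent changes by a
  multiple of sum x + sum y = 0. Only values on the index ranges are prescribed for r' and s', so
  restricted functions qualify.\<close>

lemma R23_term_shift:
  assumes a: "a = 2 * c" and rs: "(\<Sum>j=1..a. r j) + (\<Sum>i=1..b. s i) + int c = 0"
    and xy: "(\<Sum>j=1..a. x j) + (\<Sum>i=1..b. y i) = 0"
    and r': "\<And>j. j \<in> {1..a} \<Longrightarrow> r' j = r j + t" and s': "\<And>i. i \<in> {1..b} \<Longrightarrow> s' i = s i + t"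
  shows "R23_term a b x y \<tau> (r', s')
    = R23_term a b x y \<tau> (r, s) * qpow \<tau> (of_int (int (a + b) * t\<^sup>2))"
proof -
  have "(\<Sum>j=1..a. (r' j)\<^sup>2) + (\<Sum>i=1..b. (s' i)\<^sup>2) + (\<Sum>j=1..a. r' j)
      = (\<Sum>j=1..a. (r j)\<^sup>2) + (\<Sum>i=1..b. (s i)\<^sup>2) + (\<Sum>j=1..a. r j) + int (a + b) * t\<^sup>2
        + 2 * t * ((\<Sum>j=1..a. r j) + (\<Sum>i=1..b. s i) + int c)"
    by (simp add: r' s' a power2_sum sum.distrib sum_distrib_left sum_distrib_right algebra_simps)
  then have Q: "(\<Sum>j=1..a. (r' j)\<^sup>2) + (\<Sum>i=1..b. (s' i)\<^sup>2) + (\<Sum>j=1..a. r' j)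
      = (\<Sum>j=1..a. (r j)\<^sup>2) + (\<Sum>i=1..b. (s i)\<^sup>2) + (\<Sum>j=1..a. r j) + int (a + b) * t\<^sup>2"
    by (simp only: rs mult_zero_right add_0_right)
  have "(\<Sum>j=1..a. 2 * of_int (r' j) * x j) + (\<Sum>i=1..b. 2 * of_int (s' i) * y i)
      = (\<Sum>j=1..a. 2 * of_int (r j) * x j) + (\<Sum>i=1..b. 2 * of_int (s i) * y i)
        + 2 * of_int t * ((\<Sum>j=1..a. x j) + (\<Sum>i=1..b. y i))"
    by (simp add: r' s' sum.distrib sum_distrib_left algebra_simps)
  then have L: "(\<Sum>j=1..a. 2 * of_int (r' j) * x j) + (\<Sum>i=1..b. 2 * of_int (s' i) * y i)
      = (\<Sum>j=1..a. 2 * of_int (r j) * x j) + (\<Sum>i=1..b. 2 * of_int (s i) * y i)"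
    by (simp only: xy mult_zero_right add_0_right)
  have qpow_add: "qpow \<tau> (of_int (k + l)) = qpow \<tau> (of_int k) * qpow \<tau> (of_int l)" for k l
    by (simp add: qpow_def algebra_simps flip: exp_add)
  show ?thesis
    unfolding R23_term_def prod.case Q L
    by (simp only: qpow_add [of _ "int (a + b) * t\<^sup>2"] mult_ac)
qed

section \<open>Summation over k and regrouping of the tuples\<close>

theorem theorem1p11:
  fixes m n a b :: nat and x y :: "nat \<Rightarrow> complex" and \<tau> z :: complex
  assumes "Im \<tau> > 0"
    and "m > 0" and "n > 0"
    and "a + b = n" and "even a"
    and "(\<Sum>j=1..a. x j) + (\<Sum>i=1..b. y i) = 0"
  shows "(\<Sum>k<m*n.
            (\<Prod>j=1..a. jacobi_theta2 (z + x j + of_nat k * of_real pi / of_nat (m * n)) \<tau>) *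
            (\<Prod>i=1..b. jacobi_theta3 (z + y i + of_nat k * of_real pi / of_nat (m * n)) \<tau>))
         = R23 m n a b x y \<tau> * jacobi_theta3 (of_nat (m * n) * z) (of_nat (m\<^sup>2 * n) * \<tau>)"
proof -
  obtain c where a: "a = 2 * c"
    using \<open>even a\<close> by blast
  define N where "N = m * n"
  have "N > 0"
    using assms by (simp add: N_def)
  define I :: "((nat \<Rightarrow> int) \<times> (nat \<Rightarrow> int)) set"
    where "I = ({1..a} \<rightarrow>\<^sub>E UNIV) \<times> ({1..b} \<rightarrow>\<^sub>E UNIV)"
  \<comment> \<open>\<open>M u\<close> is half the coefficient of i z in the term of
    \<open>u\<close>; doubling \<open>M u = 0\<close> gives the condition in
    \<open>R23_indices\<close>.\<close>
  define M where "M = (\<lambda>(r :: nat \<Rightarrow> int, s :: nat \<Rightarrow> int). (\<Sum>j=1..a. r j) + (\<Sum>i=1..b. s i) + int c)"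
  define K where "K = qpow \<tau> (real a / 4)"
  define P where "P = R23_term a b x y \<tau>"
  have "K \<noteq> 0"
    by (simp add: K_def qpow_def)
  have indices: "R23_indices a b = {u \<in> I. M u = 0}"
    by (auto simp: R23_indices_def I_def M_def a)

  \<comment> \<open>The point \<open>w\<close> is kept general: it becomes
    \<open>z + \<omega> k\<close> in the main sum, and 0 when the summability of \<open>P\<close> is
    extracted.\<close>
  have expand: "(\<lambda>u. K * P u * exp (2 * \<i> * of_int (M u) * w)) abs_summable_on I"
      "(\<Sum>\<^sub>\<infinity>u\<in>I. K * P u * exp (2 * \<i> * of_int (M u) * w))
        = (\<Prod>j=1..a. jacobi_theta2 (w + x j) \<tau>) * (\<Prod>i=1..b. jacobi_theta3 (w + y i) \<tau>)" for w
  proof -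
    have eq: "K * P u * exp (2 * \<i> * of_int (M u) * w) = (case u of (r, s) \<Rightarrow>
        (\<Prod>j=1..a. theta2_term \<tau> (w + x j) (r j)) * (\<Prod>i=1..b. theta3_term \<tau> (w + y i) (s i)))"
      for u
      unfolding prod_theta_terms [OF a] by (simp add: K_def P_def M_def split: prod.split)
    have 2: "(\<lambda>r. \<Prod>j=1..a. theta2_term \<tau> (w + x j) (r j)) abs_summable_on ({1..a} \<rightarrow>\<^sub>E UNIV)"
      \<comment> \<open>The product rule over \<open>PiE\<close> concerns the measure-theoretic
        notion of absolute summability, hence the passage to it and back.\<close>
      unfolding abs_summable_equivalent
      by (rule abs_summable_on_prod_PiE [where f = "\<lambda>j. theta2_term \<tau> (w + x j)"])
         (use assms abs_summable_theta2_term in \<open>auto simp flip: abs_summable_equivalent\<close>)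
    have 3: "(\<lambda>s. \<Prod>i=1..b. theta3_term \<tau> (w + y i) (s i)) abs_summable_on ({1..b} \<rightarrow>\<^sub>E UNIV)"
      unfolding abs_summable_equivalent
      by (rule abs_summable_on_prod_PiE [where f = "\<lambda>j. theta3_term \<tau> (w + y j)"])
         (use assms abs_summable_theta3_term in \<open>auto simp flip: abs_summable_equivalent\<close>)
    show "(\<lambda>u. K * P u * exp (2 * \<i> * of_int (M u) * w)) abs_summable_on I"
      unfolding eq I_def by (rule abs_summable_on_times [OF 2 3])
    show "(\<Sum>\<^sub>\<infinity>u\<in>I. K * P u * exp (2 * \<i> * of_int (M u) * w))
        = (\<Prod>j=1..a. jacobi_theta2 (w + x j) \<tau>) * (\<Prod>i=1..b. jacobi_theta3 (w + y i) \<tau>)"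
      unfolding eq I_def infsum_times [OF 2 3] jacobi_theta2_infsum jacobi_theta3_infsum
      by (intro arg_cong2 [where f = "(*)"] infsum_prod_PiE_abs
          abs_summable_theta2_term abs_summable_theta3_term assms finite_atLeastAtMost)
  qed

  define \<omega> where "\<omega> k = of_nat k * complex_of_real pi / of_nat N" for k
  have "(\<Sum>k<N. (\<Prod>j=1..a. jacobi_theta2 (z + x j + \<omega> k) \<tau>) *
                (\<Prod>i=1..b. jacobi_theta3 (z + y i + \<omega> k) \<tau>))
      = (\<Sum>k<N. \<Sum>\<^sub>\<infinity>u\<in>I. K * P u * exp (2 * \<i> * of_int (M u) * (z + \<omega> k)))"
    by (simp add: expand add_ac)
  also have "\<dots> = (\<Sum>\<^sub>\<infinity>u\<in>I. \<Sum>k<N. K * P u * exp (2 * \<i> * of_int (M u) * (z + \<omega> k)))"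
    by (rule infsumI [symmetric], rule has_sum_finite_sum, rule has_sum_infsum)
       (rule abs_summable_summable [OF expand(1)])
  \<comment> \<open>Only \<open>exp (2 * \<i> * of_int (M u) * \<omega> k)\<close> depends on k, and
    it sums to the root-of-unity value.\<close>
  also have "\<dots> = (\<Sum>\<^sub>\<infinity>u\<in>I. K * P u * exp (2 * \<i> * of_int (M u) * z) *
      (if int N dvd M u then of_nat N else 0))"
    unfolding sum_exp_roots_of_unity [OF \<open>N > 0\<close>, symmetric] \<omega>_def sum_distrib_left
    by (simp only: distrib_left exp_add mult.assoc)
  also have "\<dots> = (\<Sum>\<^sub>\<infinity>u\<in>{u \<in> I. int N dvd M u}.
      of_nat N * K * (P u * exp (2 * \<i> * of_int (M u) * z)))"
    by (rule infsum_cong_neutral) auto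
  also have "\<dots> = of_nat N * K *
      (\<Sum>\<^sub>\<infinity>u\<in>{u \<in> I. int N dvd M u}. P u * exp (2 * \<i> * of_int (M u) * z))"
    by (rule infsum_cmult_right')
  also have "(\<Sum>\<^sub>\<infinity>u\<in>{u \<in> I. int N dvd M u}. P u * exp (2 * \<i> * of_int (M u) * z))
      = (\<Sum>\<^sub>\<infinity>(u, p)\<in>R23_indices a b \<times> UNIV.
          P u * theta3_term (of_nat (m\<^sup>2 * n) * \<tau>) (of_nat N * z) p)"
  proof -
    \<comment> \<open>Restricting to the index ranges keeps the tuples extensional, so that opposite
      shifts cancel as functions on \<open>I\<close>.\<close>
    define shift :: "int \<Rightarrow> (nat \<Rightarrow> int) \<times> (nat \<Rightarrow> int) \<Rightarrow> (nat \<Rightarrow> int) \<times> (nat \<Rightarrow> int)"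
      where "shift t = (\<lambda>(r, s). (\<lambda>j\<in>{1..a}. r j + t, \<lambda>i\<in>{1..b}. s i + t))" for t
    have shift_I: "shift t u \<in> I" for t u
      by (auto simp: shift_def I_def split: prod.split)
    have shift_M: "M (shift t u) = M u + int n * t" for t u
      by (auto simp: shift_def M_def sum.distrib algebra_simps \<open>a + b = n\<close> [symmetric]
          split: prod.split)
    have shift_shift: "shift t (shift t' u) = u" if "u \<in> I" "t + t' = 0" for t t' u
    proof -
      obtain r s where u: "u = (r, s)" by fastforce
      have "r j + t' + t = r j" "s j + t' + t = s j" for j
        using that by simp_all
      then show ?thesis
        using that unfolding u
        by (auto simp: shift_def I_def fun_eq_iff PiE_def extensional_def)
    qed
    \<comment> \<open>The shift by m p contributes q^(n (m p)^2), which is the nome of m^2 n \<tau>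
      to the power p^2, and it raises M from 0 to N p. Together these give the p-th term of the
      theta function at N z.\<close>
    have P_shift: "P (shift (int m * p) u) * exp (2 * \<i> * of_int (M (shift (int m * p) u)) * z)
        = P u * theta3_term (of_nat (m\<^sup>2 * n) * \<tau>) (of_nat N * z) p"
      if "M u = 0" for u p
    proof -
      obtain r s where u: "u = (r, s)" by fastforce
      have "P (shift (int m * p) u) = P u * qpow \<tau> (of_int (int (a + b) * (int m * p)\<^sup>2))"
        unfolding P_def u shift_def prod.case
        by (rule R23_term_shift [OF a _ assms(6)]) (use that in \<open>auto simp: u M_def\<close>)
      then show ?thesis
        by (simp add: \<open>a + b = n\<close> shift_M that N_def theta3_term_def qpow_def power_mult_distrib mult_ac)
    qed
    show ?thesis
    \<comment> \<open>A shift by t adds n t to M and N = m n, so p is recovered as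
      \<open>M u div int N\<close>, an exact quotient on the tuples considered; shifting back by m p
      returns to M = 0.\<close>
    proof (rule infsum_reindex_bij_witness [symmetric,
          where j = "\<lambda>(u, p). shift (int m * p) u"
            and i = "\<lambda>u. (shift (- (int m * (M u div int N))) u, M u div int N)"])
      fix v assume "v \<in> R23_indices a b \<times> (UNIV :: int set)"
      then show "P (case v of (u, p) \<Rightarrow> shift (int m * p) u) *
          exp (2 * \<i> * of_int (M (case v of (u, p) \<Rightarrow> shift (int m * p) u)) * z)
        = (case v of (u, p) \<Rightarrow> P u * theta3_term (of_nat (m\<^sup>2 * n) * \<tau>) (of_nat N * z) p)"
        using P_shift by (auto simp: indices)
    qed (use \<open>N > 0\<close> in \<open>auto simp: indices shift_I shift_M shift_shift N_def simp flip: mult.assoc\<close>)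
  qed
  also have "\<dots> = infsum P (R23_indices a b) * jacobi_theta3 (of_nat N * z) (of_nat (m\<^sup>2 * n) * \<tau>)"
    unfolding jacobi_theta3_infsum
  proof (rule infsum_times)
    \<comment> \<open>At w = 0 the exponential is 1, so \<open>K * P u\<close> is absolutely
      summable; dividing by the nonzero \<open>K\<close> leaves \<open>P\<close>.\<close>
    have "(\<lambda>u. norm (inverse K) * norm (K * P u)) summable_on I"
      using expand(1) [of 0] by (intro summable_on_cmult_right) simp
    then have "P abs_summable_on I"
      using \<open>K \<noteq> 0\<close> by (simp flip: norm_mult mult.assoc)
    then show "P abs_summable_on R23_indices a b"
      by (rule summable_on_subset_banach) (auto simp: indices)
    show "theta3_term (of_nat (m\<^sup>2 * n) * \<tau>) (of_nat N * z) abs_summable_on UNIV"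
      using assms by (intro abs_summable_theta3_term) simp
  qed
  finally show ?thesis
    unfolding \<omega>_def N_def R23_def R23_term_def P_def K_def
    by (simp only: mult.assoc)
qed

end
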